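(* Let $p>1$, $H=1/p$, and let $$T_H(t):=\sum_{m=0}^\infty2^{-mH}\operatorname{dist}(2^mt,\mathbb Z),\qquad t\in[0,1].$$ Let $q:=2^{H-1}$ and $C_p:=\mathbb E\bigl|\sum_{j=1}^\infty q^j\varepsilon_j\bigr|^p$, where $(\varepsilon_j)_{j\ge1}$ are independent symmetric $\{-1,1\}$-valued random variables. Then $$\lim_{n\to\infty}\mathsf V^p_{\Pi(2^{-n},0)}(T_H;1)=C_p,\qquad\lim_{n\to\infty}\mathsf V^p_{\Pi(2^{-n},2^{-n-1})}(T_H;1)=\frac{C_p}{2^p-1}.$$ In particular, $T_H\notin\mathscr R_p([0,1])$.
   Context: For a finite partition $\lambda=\{0=u_0<\dots<u_N=1\}$ and $t\in[0,1]$, $\mathsf V^p_\lambda(x;t):=\sum_{i}|x(u_{i+1}\wedge t)-x(u_i\wedge t)|^p$. For $0<\ell\le1$, $0\le a<\ell$, $\Pi(\ell,a):=\{0,1\}\cup\{a+k\ell:k\in\mathbb Z,\ 0<a+k\ell<1\}$. $\mathscr R_p([0,1])$ is the class of $p$-rough paths: $x\in C([0,1];\mathbb R)$ for which there is a continuous nondecreasing $A:[0,1]\to[0,\infty)$ with $A(1)>A(0)=0$ such that $\sup_{0<\ell\le\delta}\sup_{0\le a<\ell}\sup_{t\in[0,1]}|\mathsf V^p_{\Pi(\ell,a)}(x;t)-A(t)|\to0$ as $\delta\downarrow0$. *)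

theory Defs
  imports "HOL-Probability.Probability"
begin

(* A finite partition is represented by its set of points. *)
definition p_variation :: "real \<Rightarrow> real set \<Rightarrow> (real \<Rightarrow> real) \<Rightarrow> real \<Rightarrow> real" where
  "p_variation p \<pi> x t =
     (let u = sorted_list_of_set \<pi>
      in \<Sum>i<length u - 1. \<bar>x (min (u ! Suc i) t) - x (min (u ! i) t)\<bar> powr p)"

definition uniform_partition :: "real \<Rightarrow> real \<Rightarrow> real set" where
  "uniform_partition l a = {0, 1} \<union> {a + of_int k * l | k :: int. 0 < a + of_int k * l \<and> a + of_int k * l < 1}"

(* The suprema are taken in the extended reals, since they may be infinite.
   Only values on [0,1] matter, so paths are total functions on the reals.
   The restriction l <= 1 is implicit in the limit at 0 from the right. *)
definition rough_paths :: "real \<Rightarrow> (real \<Rightarrow> real) set" where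
  "rough_paths p = {x. continuous_on {0..1} x \<and>
     (\<exists>A :: real \<Rightarrow> real. continuous_on {0..1} A \<and> mono_on {0..1} A \<and> A ` {0..1} \<subseteq> {0..} \<and>
        A 0 = 0 \<and> A 1 > A 0 \<and>
        ((\<lambda>\<delta>. SUP l\<in>{0<..\<delta>}. SUP a\<in>{0..<l}. SUP t\<in>{0..1}.
             ereal \<bar>p_variation p (uniform_partition l a) x t - A t\<bar>) \<longlongrightarrow> 0) (at_right 0))}"

definition takagi :: "real \<Rightarrow> real \<Rightarrow> real" where
  "takagi H t = (\<Sum>m. 2 powr (- real m * H) * infdist (2 ^ m * t) \<int>)"

(* Independent symmetric signs, indexed by j >= 1; the two point probabilities force
   the values to lie in {-1, 1} almost surely. *)
definition rademacher_sequence :: "'a measure \<Rightarrow> (nat \<Rightarrow> 'a \<Rightarrow> real) \<Rightarrow> bool" where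
  "rademacher_sequence M \<epsilon> \<longleftrightarrow> prob_space M \<and>
     prob_space.indep_vars M (\<lambda>_. borel) \<epsilon> {1..} \<and>
     (\<forall>j\<ge>1. measure M {\<omega> \<in> space M. \<epsilon> j \<omega> = 1} = 1 / 2 \<and>
            measure M {\<omega> \<in> space M. \<epsilon> j \<omega> = -1} = 1 / 2)"

end

theory Submission
  imports Defs
begin

text \<open>The value of the Takagi function at a dyadic midpoint is the mean of the neighbouring values
  plus half of \<open>2 powr (- n * H)\<close>. Hence the increments of level \<open>n\<close>, scaled by \<open>2 powr (n * H)\<close>, obey
  the recursion \<open>a \<mapsto> q * (a \<plusminus> 1)\<close> and are distributed like the partial Rademacher sums, so that the dyadic
  variation \<open>V n\<close> is the \<open>p\<close>-th moment of such a sum. On the shifted partition, the increments around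
  even and odd points come from the previous level of the shifted and of the dyadic partition: up to
  two boundary terms the shifted variation satisfies \<open>W (n + 1) = 2 powr (- p) * (W n + V n)\<close>. A common
  limit \<open>L\<close> of \<open>V\<close> and \<open>W\<close> would satisfy \<open>L = 2 powr (1 - p) * L\<close>, so it would be \<open>0\<close>, whereas
  roughness requires \<open>L > 0\<close>.\<close>

section \<open>The Takagi function at dyadic points\<close>

lemma infdist_Ints_eq:
  fixes x :: real and k :: int
  assumes "\<bar>x - of_int k\<bar> \<le> 1 / 2"
  shows "infdist x \<int> = \<bar>x - of_int k\<bar>"
proof (rule antisym)
  show "infdist x \<int> \<le> \<bar>x - of_int k\<bar>"
    using infdist_le[of "of_int k" "\<int>" x] by (simp add: dist_real_def)
  have "\<bar>x - of_int k\<bar> \<le> \<bar>x - of_int z\<bar>" for z :: int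
  proof (cases "z = k")
    case False
    then have "\<bar>of_int z - of_int k\<bar> \<ge> (1 :: real)" by linarith
    with assms show ?thesis by linarith
  qed simp
  then show "\<bar>x - of_int k\<bar> \<le> infdist x \<int>"
    unfolding infdist_def by (auto simp: dist_real_def elim!: Ints_cases intro!: cINF_greatest)
qed

lemma infdist_Ints_le_1: "infdist (x :: real) \<int> \<le> 1"
proof -
  have "infdist x \<int> \<le> dist x (of_int \<lfloor>x\<rfloor>)" by (rule infdist_le) simp
  also have "\<dots> \<le> 1" unfolding dist_real_def by linarith
  finally show ?thesis .
qed

text \<open>The distance to the integers is affine between consecutive multiples of 1/2, and no
  dyadic interval of length \<open>1 / 2 ^ (n + 1)\<close> crosses such a multiple.\<close>

lemma infdist_Ints_dyadic_midpoint:
  fixes i :: int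
  shows "infdist ((2 * of_int i + 1) / 2 ^ (n + 2) :: real) \<int> =
    (infdist (of_int i / 2 ^ (n + 1) :: real) \<int> + infdist ((of_int i + 1) / 2 ^ (n + 1) :: real) \<int>) / 2"
proof -
  \<comment> \<open>The interval from \<open>x\<close> to \<open>y\<close> lies in the half-unit
    interval from \<open>k / 2\<close> to \<open>(k + 1) / 2\<close>. Its nearest integer is the
    left end for even \<open>k\<close> and the right end for odd \<open>k\<close>.\<close>
  define k :: int where "k = i div 2 ^ n"
  define x y :: real where "x = of_int i / 2 ^ (n + 1)" and "y = (of_int i + 1) / 2 ^ (n + 1)"
  have mid: "(2 * of_int i + 1) / 2 ^ (n + 2) = (x + y) / 2"
    by (simp add: x_def y_def field_simps)
  have k: "k * 2 ^ n + i mod 2 ^ n = i" unfolding k_def by (rule div_mult_mod_eq)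
  have m: "0 \<le> i mod 2 ^ n" "i mod 2 ^ n < 2 ^ n" by simp_all
  have "k * 2 ^ n \<le> i" using k m by linarith
  then have "of_int (k * 2 ^ n) \<le> (of_int i :: real)" by (simp only: of_int_le_iff)
  then have "of_int k * 2 ^ n \<le> (of_int i :: real)" by simp
  then have x: "of_int k / 2 \<le> x" by (simp add: x_def field_simps)
  have "i + 1 \<le> (k + 1) * 2 ^ n" using k m unfolding distrib_right by linarith
  then have "of_int (i + 1) \<le> (of_int ((k + 1) * 2 ^ n) :: real)" by (simp only: of_int_le_iff)
  then have "of_int i + 1 \<le> (of_int k + 1) * (2 :: real) ^ n" by simp
  then have y: "y \<le> (of_int k + 1) / 2" by (simp add: y_def field_simps)
  have xy: "x \<le> y" by (simp add: x_def y_def divide_right_mono)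
  show ?thesis
  proof (cases "even k")
    case True
    then obtain j where "k = 2 * j" by blast
    with x y have b: "of_int j \<le> x" "y \<le> of_int j + 1 / 2" by auto
    have d: "infdist z \<int> = z - of_int j" if "x \<le> z" "z \<le> y" for z
      using infdist_Ints_eq[of z j] b that by (simp add: abs_if)
    have "infdist ((x + y) / 2) \<int> = (infdist x \<int> + infdist y \<int>) / 2"
      using xy by (simp add: d field_simps)
    then show ?thesis unfolding mid x_def[symmetric] y_def[symmetric] .
  next
    case False
    then obtain l where "k = 2 * l + 1" by (elim oddE)
    moreover define j where "j = l + 1"
    ultimately have "k = 2 * j - 1" by simp
    with x y have b: "of_int j - 1 / 2 \<le> x" "y \<le> of_int j" by auto
    have d: "infdist z \<int> = of_int j - z" if "x \<le> z" "z \<le> y" for z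
      using infdist_Ints_eq[of z j] b that by (simp add: abs_if)
    have "infdist ((x + y) / 2) \<int> = (infdist x \<int> + infdist y \<int>) / 2"
      using xy by (simp add: d field_simps)
    then show ?thesis unfolding mid x_def[symmetric] y_def[symmetric] .
  qed
qed

lemma summable_takagi:
  fixes H t :: real
  assumes "H > 0"
  shows "summable (\<lambda>m. 2 powr (- real m * H) * infdist (2 ^ m * t) \<int>)"
proof (rule summable_comparison_test')
  have "(2 :: real) powr (- H) < 1" using assms powr_less_mono[of "- H" 0 2] by simp
  then show "summable (\<lambda>m. (2 powr (- H)) ^ m :: real)" by simp
  show "norm (2 powr (- real m * H) * infdist (2 ^ m * t) \<int>) \<le> (2 powr (- H)) ^ m" for m
    using infdist_Ints_le_1[of "2 ^ m * t"] infdist_nonneg[of "2 ^ m * t" "\<int>"]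
    by (simp add: powr_power mult.commute mult_left_le)
qed

text \<open>After the head is split off, the tail is the same series at \<open>2 * t\<close>. All
  real \<open>t\<close> are allowed because doubling leaves the unit interval.\<close>

lemma takagi_functional_equation:
  assumes "H > 0"
  shows "takagi H t = infdist t \<int> + 2 powr (- H) * takagi H (2 * t)"
proof -
  have "takagi H t = 2 powr (- real 0 * H) * infdist (2 ^ 0 * t) \<int> +
      (\<Sum>m. 2 powr (- real (Suc m) * H) * infdist (2 ^ Suc m * t) \<int>)"
    unfolding takagi_def using suminf_split_head[OF summable_takagi[OF assms, of t]] by simp
  also have "(\<Sum>m. 2 powr (- real (Suc m) * H) * infdist (2 ^ Suc m * t) \<int>) =
      (\<Sum>m. 2 powr (- H) * (2 powr (- real m * H) * infdist (2 ^ m * (2 * t)) \<int>))"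
    by (intro suminf_cong) (simp add: powr_add[symmetric] algebra_simps flip: mult.assoc)
  also have "\<dots> = 2 powr (- H) * takagi H (2 * t)"
    unfolding takagi_def by (rule suminf_mult[OF summable_takagi[OF assms]])
  finally show ?thesis by simp
qed

lemma takagi_of_int: "takagi H (of_int k) = 0"
proof -
  have "2 ^ m * of_int k \<in> (\<int> :: real set)" for m by simp
  then show ?thesis unfolding takagi_def by simp
qed

text \<open>Induction along the functional equation: doubling lowers the level by one and multiplies
  the correction term by \<open>2 powr (- H)\<close>, while the distance term is affine on the
  interval and adds no correction. At level 0 both end values vanish and the midpoint has value
  1/2.\<close>

lemma takagi_dyadic_midpoint:
  fixes i :: int
  assumes "H > 0"
  shows "takagi H ((2 * of_int i + 1) / 2 ^ (n + 1)) =
    (takagi H (of_int i / 2 ^ n) + takagi H ((of_int i + 1) / 2 ^ n)) / 2 + 2 powr (- real n * H) / 2"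
proof (induction n)
  case 0
  have "infdist ((2 * of_int i + 1) / 2 :: real) \<int> = 1 / 2"
    using infdist_Ints_eq[of "(2 * of_int i + 1) / 2" i] by (simp add: add_divide_distrib)
  moreover have "2 * ((2 * of_int i + 1) / 2) = (of_int (2 * i + 1) :: real)" by simp
  ultimately have "takagi H ((2 * of_int i + 1) / 2) = 1 / 2"
    using takagi_functional_equation[OF assms, of "(2 * of_int i + 1) / 2"]
    by (simp only: takagi_of_int)
  then show ?case
    using takagi_of_int[of H i] takagi_of_int[of H "i + 1"] by simp
next
  case (Suc n)
  note fe = takagi_functional_equation[OF assms]
  have half: "2 * (z / 2 ^ Suc m) = z / 2 ^ m" for z :: real and m by simp
  have p: "2 powr (- real (Suc n) * H) = 2 powr (- H) * 2 powr (- real n * H)"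
    by (simp add: powr_add[symmetric] algebra_simps)
  have "takagi H ((2 * of_int i + 1) / 2 ^ Suc (n + 1)) =
      infdist ((2 * of_int i + 1) / 2 ^ (n + 2) :: real) \<int> + 2 powr (- H) * takagi H ((2 * of_int i + 1) / 2 ^ (n + 1))"
    using fe[of "(2 * of_int i + 1) / 2 ^ Suc (n + 1)"] unfolding half by simp
  also have "\<dots> = (infdist (of_int i / 2 ^ Suc n :: real) \<int> + infdist ((of_int i + 1) / 2 ^ Suc n :: real) \<int>) / 2
      + 2 powr (- H) * ((takagi H (of_int i / 2 ^ n) + takagi H ((of_int i + 1) / 2 ^ n)) / 2 + 2 powr (- real n * H) / 2)"
    unfolding Suc infdist_Ints_dyadic_midpoint by simp
  finally show ?case
    unfolding fe[of "of_int i / 2 ^ Suc n"] fe[of "(of_int i + 1) / 2 ^ Suc n"] half p add_Suc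
    by (simp add: field_simps)
qed

text \<open>For \<open>H = 1 / p\<close> the \<open>p\<close>-th power of the scaling factor is
  \<open>2 ^ n\<close>, the number of intervals of level \<open>n\<close> in [0,1]. Sums of
  \<open>p\<close>-th powers of increments thus become averages.\<close>

definition scaled_increment :: "real \<Rightarrow> nat \<Rightarrow> nat \<Rightarrow> real" where
  "scaled_increment H n i =
     2 powr (real n * H) * (takagi H ((real i + 1) / 2 ^ n) - takagi H (real i / 2 ^ n))"

lemma scaled_increment_0: "scaled_increment H 0 i = 0"
  using takagi_of_int[of H "int i"] takagi_of_int[of H "int i + 1"]
  by (simp add: scaled_increment_def)

text \<open>By the midpoint formula, each half of an interval carries half of its increment, plus
  \<open>2 powr (- n * H) / 2\<close> on the left half and minus it on the right half. Rescaling to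
  level \<open>n + 1\<close> turns the factor 1/2 into \<open>2 powr (H - 1)\<close>.\<close>

lemma scaled_increment_Suc:
  assumes "H > 0"
  shows "scaled_increment H (Suc n) (2 * i) = 2 powr (H - 1) * (scaled_increment H n i + 1)"
    and "scaled_increment H (Suc n) (2 * i + 1) = 2 powr (H - 1) * (scaled_increment H n i - 1)"
proof -
  have arg: "real (2 * i) / 2 ^ Suc n = real i / 2 ^ n"
    "(real (2 * i) + 1) / 2 ^ Suc n = (2 * real i + 1) / 2 ^ (n + 1)"
    "real (2 * i + 1) / 2 ^ Suc n = (2 * real i + 1) / 2 ^ (n + 1)"
    "(real (2 * i + 1) + 1) / 2 ^ Suc n = (real i + 1) / 2 ^ n"
    by (simp_all add: field_simps)
  have p: "2 powr (real (Suc n) * H) = 2 powr (real n * H) * (2 * 2 powr (H - 1))"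
    by (simp add: powr_add powr_diff algebra_simps)
  define a :: real where "a = 2 powr (real n * H)"
  have a: "2 powr (- real n * H) = 1 / a" "a > 0" by (simp_all add: a_def powr_minus_divide)
  note mid = takagi_dyadic_midpoint[OF assms, of "int i" n, unfolded a(1) of_int_of_nat_eq]
  have "a * (2 * c) * (z - x) = c * (a * (y - x) + 1)" "a * (2 * c) * (y - z) = c * (a * (y - x) - 1)"
    if "z = (x + y) / 2 + 1 / a / 2" for x y z c
    unfolding that using a(2) by (simp_all add: field_simps)
  note alg = this[OF mid]
  show "scaled_increment H (Suc n) (2 * i) = 2 powr (H - 1) * (scaled_increment H n i + 1)"
    unfolding scaled_increment_def p a_def[symmetric] arg by (rule alg(1))
  show "scaled_increment H (Suc n) (2 * i + 1) = 2 powr (H - 1) * (scaled_increment H n i - 1)"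
    unfolding scaled_increment_def p a_def[symmetric] arg by (rule alg(2))
qed

text \<open>With \<open>q = 2 powr (H - 1)\<close>, the bound is the fixed point of
  \<open>x \<mapsto> q * (x + 1)\<close>, which dominates the passage from an interval to its
  halves.\<close>

lemma abs_scaled_increment_le:
  assumes "0 < H" "H < 1"
  shows "\<bar>scaled_increment H n i\<bar> \<le> 2 powr (H - 1) / (1 - 2 powr (H - 1))"
proof (induction n arbitrary: i)
  case 0
  have "(2 :: real) powr (H - 1) < 1" using assms powr_less_mono[of "H - 1" 0 2] by simp
  then show ?case by (simp add: scaled_increment_0)
next
  case (Suc n)
  define q :: real where "q = 2 powr (H - 1)"
  have q: "0 < q" "q < 1" using assms powr_less_mono[of "H - 1" 0 2] by (simp_all add: q_def)
  define j where "j = i div 2"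
  have j: "i = 2 * j \<or> i = 2 * j + 1" unfolding j_def by presburger
  have "\<bar>scaled_increment H (Suc n) i\<bar> \<le> q * (\<bar>scaled_increment H n j\<bar> + 1)"
    using j q scaled_increment_Suc[OF assms(1), of n j] 
    by (auto simp: q_def[symmetric] abs_mult simp del: One_nat_def)
  also have "\<dots> \<le> q * (q / (1 - q) + 1)"
    using Suc[of j] q by (intro mult_left_mono) (auto simp: q_def)
  also have "\<dots> = q / (1 - q)" using q by (simp add: field_simps)
  finally show ?case by (simp add: q_def)
qed

lemma sum_lessThan_double:
  fixes f :: "nat \<Rightarrow> 'a :: comm_monoid_add"
  shows "(\<Sum>i<2 * N. f i) = (\<Sum>i<N. f (2 * i)) + (\<Sum>i<N. f (2 * i + 1))"
  by (induction N) (simp_all add: ac_simps)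

text \<open>This is the expectation of \<open>f\<close> at the scaled increment of a uniformly
  chosen interval of level \<open>n\<close>. The function \<open>f\<close> stays general because the
  recursion over levels is absorbed into it.\<close>

definition dyadic_mean :: "real \<Rightarrow> nat \<Rightarrow> (real \<Rightarrow> real) \<Rightarrow> real" where
  "dyadic_mean H n f = (\<Sum>i<2 ^ n. f (scaled_increment H n i)) / 2 ^ n"

lemma dyadic_mean_Suc:
  assumes "H > 0"
  shows "dyadic_mean H (Suc n) f =
    (dyadic_mean H n (\<lambda>x. f (2 powr (H - 1) * (x + 1))) + dyadic_mean H n (\<lambda>x. f (2 powr (H - 1) * (x - 1)))) / 2"
  unfolding dyadic_mean_def power_Suc sum_lessThan_double scaled_increment_Suc[OF assms]
  by (simp add: field_simps)

section \<open>Rademacher sums\<close>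

lemma (in prob_space) indep_vars_reindex:
  assumes "inj_on f I" "indep_vars N X (f ` I)"
  shows "indep_vars (\<lambda>i. N (f i)) (\<lambda>i. X (f i)) I"
  unfolding indep_vars_def2
proof
  show "\<forall>i\<in>I. X (f i) \<in> measurable M (N (f i))"
    using assms(2) by (auto simp: indep_vars_def2)
  define F where "F = (\<lambda>i. {X i -` A \<inter> space M |A. A \<in> sets (N i)})"
  have F: "indep_sets F (f ` I)" using assms(2) by (simp add: indep_vars_def2 F_def)
  have "indep_sets (\<lambda>i. F (f i)) I"
    unfolding indep_sets_def
  proof (intro conjI ballI allI impI)
    show "F (f i) \<subseteq> events" if "i \<in> I" for i
      using F that by (auto simp: indep_sets_def)
    fix J A assume J: "J \<subseteq> I" "J \<noteq> {}" "finite J" and A: "A \<in> (\<Pi> j\<in>J. F (f j))"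
    \<comment> \<open>The events are transported to the image index set, where the independence of
      \<open>X\<close> applies.\<close>
    define B where "B = A \<circ> inv_into I f"
    have B: "B (f j) = A j" if "j \<in> J" for j
      using that J assms(1) by (auto simp: B_def)
    have inj: "inj_on f J" using assms(1) J(1) by (rule inj_on_subset)
    have "prob (\<Inter>k\<in>f ` J. B k) = (\<Prod>k\<in>f ` J. prob (B k))"
      using J A B by (intro indep_setsD[OF F]) auto
    then show "prob (\<Inter>j\<in>J. A j) = (\<Prod>j\<in>J. prob (A j))"
      using B by (simp add: prod.reindex[OF inj])
  qed
  then show "indep_sets (\<lambda>i. {X (f i) -` A \<inter> space M |A. A \<in> sets (N (f i))}) I"
    by (simp add: F_def)
qed

text \<open>The induction on the number of signs removes the first sign and continues with the
  rest.\<close>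

lemma rademacher_sequence_Suc:
  assumes "rademacher_sequence M \<epsilon>"
  shows "rademacher_sequence M (\<lambda>j. \<epsilon> (Suc j))"
proof -
  interpret prob_space M using assms by (simp add: rademacher_sequence_def)
  have "indep_vars (\<lambda>_. borel) \<epsilon> {1..}" using assms by (simp add: rademacher_sequence_def)
  then have "indep_vars (\<lambda>_. borel) \<epsilon> (Suc ` {1..})"
    by (rule indep_vars_subset) auto
  from indep_vars_reindex[OF _ this]
  have "indep_vars (\<lambda>_. borel) (\<lambda>j. \<epsilon> (Suc j)) {1..}" by simp
  then show ?thesis using assms by (simp add: rademacher_sequence_def)
qed

lemma rademacher_sequence_measurable:
  assumes "rademacher_sequence M \<epsilon>"
  shows "\<epsilon> (Suc j) \<in> borel_measurable M"
proof -
  interpret prob_space M using assms by (simp add: rademacher_sequence_def)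
  have "indep_vars (\<lambda>_. borel) \<epsilon> {1..}" using assms by (simp add: rademacher_sequence_def)
  then show ?thesis by (auto simp: indep_vars_def)
qed

lemma rademacher_sequence_AE:
  assumes "rademacher_sequence M \<epsilon>"
  shows "AE \<omega> in M. \<epsilon> (Suc j) \<omega> = 1 \<or> \<epsilon> (Suc j) \<omega> = - 1"
proof -
  interpret prob_space M using assms by (simp add: rademacher_sequence_def)
  note [measurable] = rademacher_sequence_measurable[OF assms, of j]
  have "prob ({\<omega> \<in> space M. \<epsilon> (Suc j) \<omega> = 1} \<union> {\<omega> \<in> space M. \<epsilon> (Suc j) \<omega> = - 1}) =
      prob {\<omega> \<in> space M. \<epsilon> (Suc j) \<omega> = 1} + prob {\<omega> \<in> space M. \<epsilon> (Suc j) \<omega> = - 1}"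
    by (rule finite_measure_Union) auto
  also have "\<dots> = 1 / 2 + 1 / 2"
    using assms unfolding rademacher_sequence_def by (intro arg_cong2[where f = "(+)"]) auto
  finally have "prob ({\<omega> \<in> space M. \<epsilon> (Suc j) \<omega> = 1} \<union> {\<omega> \<in> space M. \<epsilon> (Suc j) \<omega> = - 1}) = 1"
    by simp
  then have "AE \<omega> in M. \<omega> \<in> {\<omega> \<in> space M. \<epsilon> (Suc j) \<omega> = 1} \<union> {\<omega> \<in> space M. \<epsilon> (Suc j) \<omega> = - 1}"
    by (subst prob_eq_1[symmetric]) auto
  then show ?thesis by eventually_elim auto
qed

text \<open>The geometric series gives a bound independent of \<open>n\<close>. It provides both
  integrability and the dominating constant for the limit of moments.\<close>

lemma rademacher_sum_AE_bound:
  assumes "rademacher_sequence M \<epsilon>" "0 \<le> q" "q < 1"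
  shows "AE \<omega> in M. \<bar>\<Sum>j<n. q ^ Suc j * \<epsilon> (Suc j) \<omega>\<bar> \<le> q / (1 - q)"
proof -
  have "AE \<omega> in M. \<forall>j. \<epsilon> (Suc j) \<omega> = 1 \<or> \<epsilon> (Suc j) \<omega> = - 1"
    using rademacher_sequence_AE[OF assms(1)] by (simp add: AE_all_countable)
  then show ?thesis
  proof eventually_elim
    case (elim \<omega>)
    have e: "\<bar>\<epsilon> (Suc j) \<omega>\<bar> = 1" for j using spec[OF elim, of j] by auto
    have "\<bar>\<Sum>j<n. q ^ Suc j * \<epsilon> (Suc j) \<omega>\<bar> \<le> (\<Sum>j<n. \<bar>q ^ Suc j * \<epsilon> (Suc j) \<omega>\<bar>)"
      by (rule sum_abs)
    also have "\<dots> = (\<Sum>j<n. q ^ Suc j)" using assms by (simp add: abs_mult e)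
    also have "\<dots> = q * (\<Sum>j<n. q ^ j)" by (simp add: sum_distrib_left)
    also have "\<dots> \<le> q * (1 / (1 - q))"
    proof (rule mult_left_mono)
      have "(\<Sum>j<n. q ^ j) \<le> (\<Sum>j. q ^ j)"
        using assms by (intro sum_le_suminf) auto
      then show "(\<Sum>j<n. q ^ j) \<le> 1 / (1 - q)" using assms by (simp add: suminf_geometric)
    qed (use assms in simp)
    finally show ?case by simp
  qed
qed

text \<open>Almost surely the sum stays in a compact interval, on which the continuous function
  \<open>g\<close> is bounded.\<close>

lemma rademacher_sum_integrable:
  fixes g :: "real \<Rightarrow> real"
  assumes "rademacher_sequence M \<epsilon>" "0 \<le> q" "q < 1" "continuous_on UNIV g"
  shows "integrable M (\<lambda>\<omega>. g (\<Sum>j<n. q ^ Suc j * \<epsilon> (Suc j) \<omega>))"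
proof -
  interpret prob_space M using assms by (simp add: rademacher_sequence_def)
  note [measurable] = rademacher_sequence_measurable[OF assms(1)]
  have [measurable]: "g \<in> borel_measurable borel"
    using assms(4) by (rule borel_measurable_continuous_onI)
  define K where "K = q / (1 - q)"
  have "compact (g ` {- K..K})"
    using assms(4) by (intro compact_continuous_image) (auto intro: continuous_on_subset)
  then obtain B where B: "\<And>x. x \<in> {- K..K} \<Longrightarrow> norm (g x) \<le> B"
    by (meson bounded_iff compact_imp_bounded imageI)
  show ?thesis
  proof (rule integrable_const_bound[where B = B])
    show "AE \<omega> in M. norm (g (\<Sum>j<n. q ^ Suc j * \<epsilon> (Suc j) \<omega>)) \<le> B"
      using rademacher_sum_AE_bound[OF assms(1-3), of n]
    proof eventually_elim
      case (elim \<omega>)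
      then show ?case by (intro B) (auto simp: K_def abs_le_iff)
    qed
  qed measurable
qed

text \<open>Conditioning on the first sign turns the sum into an independent, shifted copy of itself.\<close>

lemma rademacher_sum_expectation_Suc:
  fixes f :: "real \<Rightarrow> real" and n :: nat
  assumes "rademacher_sequence M \<epsilon>" "0 \<le> q" "q < 1" "continuous_on UNIV f"
  defines "Y \<equiv> \<lambda>\<omega>. \<Sum>j<n. q ^ Suc j * \<epsilon> (Suc (Suc j)) \<omega>"
  shows "(\<integral>\<omega>. f (\<Sum>j<Suc n. q ^ Suc j * \<epsilon> (Suc j) \<omega>) \<partial>M) =
    ((\<integral>\<omega>. f (q * (Y \<omega> + 1)) \<partial>M) + (\<integral>\<omega>. f (q * (Y \<omega> - 1)) \<partial>M)) / 2"
proof -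
  interpret prob_space M using assms by (simp add: rademacher_sequence_def)
  note [measurable] = rademacher_sequence_measurable[OF assms(1)]
  note shift = rademacher_sequence_Suc[OF assms(1)]
  have Ym[measurable]: "Y \<in> borel_measurable M" unfolding Y_def by measurable
  have fm[measurable]: "f \<in> borel_measurable borel"
    using assms(4) by (rule borel_measurable_continuous_onI)
  have indep: "indep_var borel (\<epsilon> 1) borel Y"
  proof -
    have "indep_vars (\<lambda>_. borel) \<epsilon> {1..}" using assms by (simp add: rademacher_sequence_def)
    \<comment> \<open>The exponent \<open>j - 1\<close> gives the first sign weight 1 and the sign
      with index \<open>Suc (Suc j)\<close> weight \<open>q ^ Suc j\<close>, as in \<open>Y\<close>.
      Grouping the indices then separates \<open>\<epsilon> 1\<close> from \<open>Y\<close>.\<close>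
    then have "indep_vars (\<lambda>_. borel) (\<lambda>j \<omega>. q ^ (j - 1) * \<epsilon> j \<omega>) {1..}"
      by (rule indep_vars_compose2) simp
    then have "indep_vars (\<lambda>_. borel) (\<lambda>j \<omega>. q ^ (j - 1) * \<epsilon> j \<omega>) (insert 1 ((\<lambda>j. Suc (Suc j)) ` {..<n}))"
      by (rule indep_vars_subset) auto
    then have "indep_var borel (\<lambda>\<omega>. q ^ (1 - 1) * \<epsilon> 1 \<omega>) borel
        (\<lambda>\<omega>. \<Sum>j\<in>(\<lambda>j. Suc (Suc j)) ` {..<n}. q ^ (j - 1) * \<epsilon> j \<omega>)"
      by (intro indep_vars_sum) auto
    moreover have "(\<lambda>\<omega>. \<Sum>j\<in>(\<lambda>j. Suc (Suc j)) ` {..<n}. q ^ (j - 1) * \<epsilon> j \<omega>) = Y"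
      by (simp add: sum.reindex inj_on_def Y_def)
    ultimately show ?thesis by simp
  qed
  have int: "integrable M (\<lambda>\<omega>. f (q * (Y \<omega> + s)))" for s
    unfolding Y_def
    by (rule rademacher_sum_integrable[OF shift assms(2,3), where g = "\<lambda>y. f (q * (y + s))"])
      (intro continuous_on_compose2[OF assms(4)] continuous_intros subset_UNIV)
  \<comment> \<open>The event that the first sign equals \<open>s\<close> has probability 1/2 and is
    independent of \<open>Y\<close>, so the expectation of the product factors.\<close>
  have ind: "integrable M (\<lambda>\<omega>. indicat_real {s} (\<epsilon> 1 \<omega>) * f (q * (Y \<omega> + s)))" 
    and split: "(\<integral>\<omega>. indicat_real {s} (\<epsilon> 1 \<omega>) * f (q * (Y \<omega> + s)) \<partial>M) = (\<integral>\<omega>. f (q * (Y \<omega> + s)) \<partial>M) / 2"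
    if s: "s = 1 \<or> s = - 1" for s
  proof -
    have iv: "indep_var borel (indicat_real {s} \<circ> \<epsilon> 1) borel ((\<lambda>y. f (q * (y + s))) \<circ> Y)"
      by (rule indep_var_compose[OF indep]) measurable
    have i1: "integrable M (indicat_real {s} \<circ> \<epsilon> 1)"
      using rademacher_sequence_measurable[OF assms(1), of 0]
      by (intro integrable_const_bound[where B = 1]) (auto simp: indicator_def)
    have i2: "integrable M ((\<lambda>y. f (q * (y + s))) \<circ> Y)" using int by (simp add: comp_def)
    show "integrable M (\<lambda>\<omega>. indicat_real {s} (\<epsilon> 1 \<omega>) * f (q * (Y \<omega> + s)))"
      using indep_var_integrable[OF iv i1 i2] by simp
    have "(\<integral>\<omega>. (indicat_real {s} \<circ> \<epsilon> 1) \<omega> \<partial>M) = (\<integral>\<omega>. indicat_real {\<omega> \<in> space M. \<epsilon> 1 \<omega> = s} \<omega> \<partial>M)"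
      by (intro Bochner_Integration.integral_cong) (auto simp: indicator_def)
    also have "\<dots> = prob {\<omega> \<in> space M. \<epsilon> 1 \<omega> = s}" by (simp add: Int_absorb2 Collect_restrict)
    also have "\<dots> = 1 / 2" using assms(1) s by (auto simp: rademacher_sequence_def)
    finally show "(\<integral>\<omega>. indicat_real {s} (\<epsilon> 1 \<omega>) * f (q * (Y \<omega> + s)) \<partial>M) = (\<integral>\<omega>. f (q * (Y \<omega> + s)) \<partial>M) / 2"
      using indep_var_lebesgue_integral[OF iv i1 i2] by simp
  qed
  have first: "(\<Sum>j<Suc n. q ^ Suc j * \<epsilon> (Suc j) \<omega>) = q * (Y \<omega> + \<epsilon> 1 \<omega>)" for \<omega>
    unfolding sum.lessThan_Suc_shift Y_def
    by (simp add: sum_distrib_left algebra_simps)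
  \<comment> \<open>Almost surely exactly one of the two indicators is 1, and it selects the
    matching shift of \<open>Y\<close>.\<close>
  have "(\<integral>\<omega>. f (\<Sum>j<Suc n. q ^ Suc j * \<epsilon> (Suc j) \<omega>) \<partial>M) =
      (\<integral>\<omega>. indicat_real {1} (\<epsilon> 1 \<omega>) * f (q * (Y \<omega> + 1)) +
           indicat_real {- 1} (\<epsilon> 1 \<omega>) * f (q * (Y \<omega> + - 1)) \<partial>M)"
  proof (rule integral_cong_AE)
    have [measurable]: "\<epsilon> 1 \<in> borel_measurable M"
      using rademacher_sequence_measurable[OF assms(1), of 0] by simp
    show "(\<lambda>\<omega>. indicat_real {1} (\<epsilon> 1 \<omega>) * f (q * (Y \<omega> + 1)) +
           indicat_real {- 1} (\<epsilon> 1 \<omega>) * f (q * (Y \<omega> + - 1))) \<in> borel_measurable M"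
      by measurable
    show "AE \<omega> in M. f (\<Sum>j<Suc n. q ^ Suc j * \<epsilon> (Suc j) \<omega>) =
      indicat_real {1} (\<epsilon> 1 \<omega>) * f (q * (Y \<omega> + 1)) + indicat_real {- 1} (\<epsilon> 1 \<omega>) * f (q * (Y \<omega> + - 1))"
      using rademacher_sequence_AE[OF assms(1), of 0]
      unfolding first by eventually_elim auto
  qed measurable
  also have "\<dots> = ((\<integral>\<omega>. f (q * (Y \<omega> + 1)) \<partial>M) + (\<integral>\<omega>. f (q * (Y \<omega> - 1)) \<partial>M)) / 2"
    using split[of 1] split[of "- 1"] ind[of 1] ind[of "- 1"] by simp
  finally show ?thesis .
qed

text \<open>Both sides equal \<open>f 0\<close> for \<open>n = 0\<close> and obey the same
  recursion. The induction generalises \<open>f\<close>, which is composed with the two affine maps,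
  and the sign sequence, which is shifted.\<close>

lemma dyadic_mean_eq_expectation:
  fixes f :: "real \<Rightarrow> real"
  assumes "0 < H" "H < 1" "q = 2 powr (H - 1)" "rademacher_sequence M \<epsilon>" "continuous_on UNIV f"
  shows "dyadic_mean H n f = (\<integral>\<omega>. f (\<Sum>j<n. q ^ Suc j * \<epsilon> (Suc j) \<omega>) \<partial>M)"
  using assms(4,5)
proof (induction n arbitrary: f \<epsilon>)
  case 0
  then interpret prob_space M by (simp add: rademacher_sequence_def)
  show ?case by (simp add: dyadic_mean_def scaled_increment_0 prob_space)
next
  case (Suc n)
  have q: "0 \<le> q" "q < 1" using assms(1-3) powr_less_mono[of "H - 1" 0 2] by simp_all
  have "continuous_on UNIV (\<lambda>x. f (q * (x + 1)))" "continuous_on UNIV (\<lambda>x. f (q * (x - 1)))"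
    by (intro continuous_on_compose2[OF Suc.prems(2)] continuous_intros subset_UNIV)+
  then show ?case
    unfolding dyadic_mean_Suc[OF assms(1)] assms(3)[symmetric]
      rademacher_sum_expectation_Suc[OF Suc.prems(1) q Suc.prems(2)]
    using Suc.IH[OF rademacher_sequence_Suc[OF Suc.prems(1)]] by simp
qed

text \<open>Dominated convergence: almost surely the series converges absolutely, and its partial
  sums are bounded by the constant \<open>q / (1 - q)\<close>.\<close>

lemma rademacher_series_moment_LIMSEQ:
  assumes "rademacher_sequence M \<epsilon>" "0 \<le> q" "q < 1" "p > 0"
  shows "(\<lambda>n. \<integral>\<omega>. \<bar>\<Sum>j<n. q ^ Suc j * \<epsilon> (Suc j) \<omega>\<bar> powr p \<partial>M)
    \<longlonglongrightarrow> (\<integral>\<omega>. \<bar>\<Sum>j. q ^ Suc j * \<epsilon> (Suc j) \<omega>\<bar> powr p \<partial>M)"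
proof (rule integral_dominated_convergence[where w = "\<lambda>_. (q / (1 - q)) powr p"])
  interpret prob_space M using assms by (simp add: rademacher_sequence_def)
  note [measurable] = rademacher_sequence_measurable[OF assms(1)]
  show "(\<lambda>\<omega>. \<bar>\<Sum>j. q ^ Suc j * \<epsilon> (Suc j) \<omega>\<bar> powr p) \<in> borel_measurable M"
    by measurable
  show "(\<lambda>\<omega>. \<bar>\<Sum>j<n. q ^ Suc j * \<epsilon> (Suc j) \<omega>\<bar> powr p) \<in> borel_measurable M" for n
    by measurable
  show "integrable M (\<lambda>_. (q / (1 - q)) powr p)" by simp
  show "AE \<omega> in M. norm (\<bar>\<Sum>j<n. q ^ Suc j * \<epsilon> (Suc j) \<omega>\<bar> powr p) \<le> (q / (1 - q)) powr p" for n
    using rademacher_sum_AE_bound[OF assms(1-3), of n]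
    by eventually_elim (use assms in \<open>auto intro!: powr_mono2\<close>)
  have "AE \<omega> in M. \<forall>j. \<epsilon> (Suc j) \<omega> = 1 \<or> \<epsilon> (Suc j) \<omega> = - 1"
    using rademacher_sequence_AE[OF assms(1)] by (simp add: AE_all_countable)
  then show "AE \<omega> in M. (\<lambda>n. \<bar>\<Sum>j<n. q ^ Suc j * \<epsilon> (Suc j) \<omega>\<bar> powr p)
      \<longlonglongrightarrow> \<bar>\<Sum>j. q ^ Suc j * \<epsilon> (Suc j) \<omega>\<bar> powr p"
  proof eventually_elim
    case (elim \<omega>)
    have e: "\<bar>\<epsilon> (Suc j) \<omega>\<bar> = 1" for j using spec[OF elim, of j] by auto
    have "summable (\<lambda>j. q ^ Suc j * \<epsilon> (Suc j) \<omega>)"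
    proof (rule summable_comparison_test')
      show "summable (\<lambda>j. q ^ j)" using assms by simp
      show "norm (q ^ Suc j * \<epsilon> (Suc j) \<omega>) \<le> q ^ j" for j
        using assms by (simp add: abs_mult e mult_left_le_one_le)
    qed
    then have "(\<lambda>n. \<Sum>j<n. q ^ Suc j * \<epsilon> (Suc j) \<omega>) \<longlonglongrightarrow> (\<Sum>j. q ^ Suc j * \<epsilon> (Suc j) \<omega>)"
      by (rule summable_LIMSEQ)
    then show ?case using assms(4) by (intro tendsto_intros) auto
  qed
qed

section \<open>Variation along uniform partitions\<close>

text \<open>A strictly increasing enumeration is already the sorted list of its range, and
  truncation at \<open>t\<close> is void when no point exceeds \<open>t\<close>.\<close>

lemma p_variation_image:
  fixes u :: "nat \<Rightarrow> real"
  assumes "strict_mono_on {..N} u" "\<And>i. i \<le> N \<Longrightarrow> u i \<le> t"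
  shows "p_variation p (u ` {..N}) x t = (\<Sum>i<N. \<bar>x (u (Suc i)) - x (u i)\<bar> powr p)"
proof -
  have inj: "inj_on u {..N}" using assms(1) by (rule strict_mono_on_imp_inj_on)
  have "sorted_list_of_set (set (map u [0..<Suc N])) = map u [0..<Suc N]"
  proof (rule sorted_list_of_set.idem_if_sorted_distinct)
    show "sorted (map u [0..<Suc N])"
      using assms(1) unfolding sorted_map
      by (intro sorted_wrt_mono_rel[OF _ sorted_upt])
        (auto simp: strict_mono_on_def le_less)
    show "distinct (map u [0..<Suc N])"
      using inj by (simp add: distinct_map atLeast0LessThan lessThan_Suc_atMost del: upt_Suc)
  qed
  moreover have "set (map u [0..<Suc N]) = u ` {..N}"
    by (simp add: atLeast0LessThan lessThan_Suc_atMost del: upt_Suc)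
  ultimately have l: "sorted_list_of_set (u ` {..N}) = map u [0..<Suc N]" by (simp only:)
  show ?thesis
    unfolding p_variation_def l Let_def using assms(2)
    by (intro sum.cong) (auto simp: nth_append simp del: upt_Suc)
qed

lemma uniform_partition_dyadic:
  "uniform_partition (1 / 2 ^ n) 0 = (\<lambda>i. real i / 2 ^ n) ` {..2 ^ n}"
proof (intro equalityI subsetI)
  fix y assume "y \<in> uniform_partition (1 / 2 ^ n) 0"
  then consider "y = 0" | "y = 1" | k :: int where "y = of_int k / 2 ^ n" "0 < y" "y < 1"
    by (auto simp: uniform_partition_def)
  then show "y \<in> (\<lambda>i. real i / 2 ^ n) ` {..2 ^ n}"
  proof cases
    case 3
    then have k: "0 < k" "of_int k < (2 :: real) ^ n" by (simp_all add: zero_less_divide_iff)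
    then have "real (nat k) \<le> 2 ^ n" by simp
    then have "nat k \<le> 2 ^ n" by simp
    then show ?thesis using 3 k by (intro image_eqI[of _ _ "nat k"]) auto
  qed (auto intro: image_eqI[of _ _ 0] image_eqI[of _ _ "2 ^ n"])
next
  fix y assume "y \<in> (\<lambda>i. real i / 2 ^ n) ` {..2 ^ n}"
  then obtain i where i: "i \<le> 2 ^ n" "y = real i / 2 ^ n" by auto
  show "y \<in> uniform_partition (1 / 2 ^ n) 0"
  proof (cases "i = 0 \<or> i = 2 ^ n")
    case True
    then show ?thesis using i by (auto simp: uniform_partition_def)
  next
    case False
    then have "0 < i" "i < 2 ^ n" using i by auto
    then have "real i < 2 ^ n" by simp
    then show ?thesis using i \<open>0 < i\<close> unfolding uniform_partition_def
      by (intro UnI2 CollectI exI[of _ "int i"]) auto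
  qed
qed

text \<open>The points strictly between the ends are the midpoints of the dyadic intervals of level
  \<open>n\<close>. The formula would leave [0,1] at indices 0 and \<open>2 ^ n + 1\<close>, which
  enumerate the endpoints instead.\<close>

definition shifted_point :: "nat \<Rightarrow> nat \<Rightarrow> real" where
  "shifted_point n i = (if i = 0 then 0 else if i = 2 ^ n + 1 then 1 else (2 * real i - 1) / 2 ^ (n + 1))"

lemma uniform_partition_shifted:
  "uniform_partition (1 / 2 ^ n) (1 / 2 ^ (n + 1)) = shifted_point n ` {..2 ^ n + 1}"
proof (intro equalityI subsetI)
  have eq: "1 / 2 ^ (n + 1) + z * (1 / 2 ^ n) = (2 * z + 1) / 2 ^ (n + 1)" for z :: real
    by (simp add: field_simps)
  {
    fix y assume "y \<in> uniform_partition (1 / 2 ^ n) (1 / 2 ^ (n + 1))"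
    then consider "y = 0" | "y = 1" | k :: int where "y = (2 * of_int k + 1) / 2 ^ (n + 1)" "0 < y" "y < 1"
      unfolding uniform_partition_def eq by auto
    then show "y \<in> shifted_point n ` {..2 ^ n + 1}"
    proof cases
      case 3
      then have "0 < 2 * k + 1" and "2 * of_int k + 1 < (2 :: real) ^ (n + 1)"
        by (simp_all add: zero_less_divide_iff)
      then have k: "0 \<le> k" by simp
      have "real_of_int k < 2 ^ n"
        using \<open>2 * of_int k + 1 < (2 :: real) ^ (n + 1)\<close> by (simp only: power_add power_one_right)
      then have "real (nat k) < 2 ^ n" by simp
      then have "nat k < 2 ^ n" by simp
      \<comment> \<open>Index 0 belongs to the endpoint 0, so the midpoint with number
        \<open>k\<close> has index \<open>k + 1\<close>.\<close>
      then show ?thesis using 3 k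
        by (intro image_eqI[of _ _ "Suc (nat k)"]) (auto simp: shifted_point_def)
    next
      case 1
      then show ?thesis by (intro image_eqI[of _ _ 0]) (auto simp: shifted_point_def)
    next
      case 2
      then show ?thesis by (intro image_eqI[of _ _ "2 ^ n + 1"]) (auto simp: shifted_point_def)
    qed
  }
  fix y assume "y \<in> shifted_point n ` {..2 ^ n + 1}"
  then obtain i where i: "i \<le> 2 ^ n + 1" "y = shifted_point n i" by auto
  show "y \<in> uniform_partition (1 / 2 ^ n) (1 / 2 ^ (n + 1))"
  proof (cases "i = 0 \<or> i = 2 ^ n + 1")
    case True
    then show ?thesis using i by (auto simp: uniform_partition_def shifted_point_def)
  next
    case False
    then obtain j where j: "i = Suc j" "j < 2 ^ n" using i by (cases i) auto
    then have "real (Suc j) \<le> 2 ^ n" by (simp only: of_nat_le_numeral_power_cancel_iff Suc_le_eq)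
    then have "real j + 1 \<le> 2 ^ n" by simp
    then show ?thesis using i j unfolding uniform_partition_def eq
      by (intro UnI2 CollectI exI[of _ "int j"]) (auto simp: shifted_point_def add_pos_nonneg)
  qed
qed

lemma strict_mono_on_shifted_point: "strict_mono_on {..2 ^ n + 1} (shifted_point n)"
proof (rule strict_mono_onI)
  fix i j :: nat assume ij: "i \<in> {..2 ^ n + 1}" "j \<in> {..2 ^ n + 1}" "i < j"
  have b: "real k \<le> 2 ^ n" if "k \<le> 2 ^ n" for k :: nat
    using that by simp
  show "shifted_point n i < shifted_point n j"
  proof (cases "j = 2 ^ n + 1")
    case True
    with ij have "real i \<le> 2 ^ n" by (intro b) simp
    then have "2 * real i - 1 < 2 * 2 ^ n" by linarith
    with True ij show ?thesis by (auto simp: shifted_point_def)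
  next
    case False
    with ij show ?thesis by (auto simp: shifted_point_def divide_strict_right_mono)
  qed
qed

section \<open>Variation of the Takagi function along dyadic and shifted partitions\<close>

lemma powr_scaled_increment:
  assumes "p > 0" "H = 1 / p"
  shows "\<bar>takagi H ((real i + 1) / 2 ^ n) - takagi H (real i / 2 ^ n)\<bar> powr p =
    \<bar>scaled_increment H n i\<bar> powr p / 2 ^ n"
  using assms by (simp add: scaled_increment_def abs_mult powr_mult powr_powr powr_realpow)

lemma p_variation_takagi_dyadic:
  assumes "p > 0" "H = 1 / p"
  shows "p_variation p (uniform_partition (1 / 2 ^ n) 0) (takagi H) 1 =
    dyadic_mean H n (\<lambda>x. \<bar>x\<bar> powr p)"
proof -
  have b: "real k \<le> 2 ^ n" if "k \<le> 2 ^ n" for k :: nat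
    using that by simp
  have "p_variation p (uniform_partition (1 / 2 ^ n) 0) (takagi H) 1 =
      (\<Sum>i<2 ^ n. \<bar>takagi H (real (Suc i) / 2 ^ n) - takagi H (real i / 2 ^ n)\<bar> powr p)"
    unfolding uniform_partition_dyadic
    by (intro p_variation_image) (auto simp: strict_mono_on_def divide_strict_right_mono b)
  also have "\<dots> = dyadic_mean H n (\<lambda>x. \<bar>x\<bar> powr p)"
    unfolding dyadic_mean_def sum_divide_distrib powr_scaled_increment[OF assms, symmetric]
    by (simp add: add.commute)
  finally show ?thesis .
qed

text \<open>By the midpoint formula the summand is the increment of \<^term>\<open>takagi H\<close> over the interval
  of length \<open>1 / 2 ^ n\<close> centred at \<open>i / 2 ^ n\<close>.\<close>

definition interior_variation :: "real \<Rightarrow> real \<Rightarrow> nat \<Rightarrow> real" where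
  "interior_variation p H n =
     (\<Sum>i\<in>{1..<2 ^ n}. \<bar>(takagi H ((real i + 1) / 2 ^ n) - takagi H ((real i - 1) / 2 ^ n)) / 2\<bar> powr p)"

text \<open>The first and last intervals have half length, hence are dyadic of level
  \<open>n + 1\<close>. Every other one joins the midpoints of two adjacent intervals of level
  \<open>n\<close>, so the correction terms of the midpoint formula cancel.\<close>

lemma p_variation_takagi_shifted:
  assumes "p > 0" "H = 1 / p"
  shows "p_variation p (uniform_partition (1 / 2 ^ n) (1 / 2 ^ (n + 1))) (takagi H) 1 =
    interior_variation p H n +
    (\<bar>scaled_increment H (n + 1) 0\<bar> powr p + \<bar>scaled_increment H (n + 1) (2 ^ (n + 1) - 1)\<bar> powr p) / 2 ^ (n + 1)"
proof -
  have H: "H > 0" using assms by simp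
  let ?d = "\<lambda>i. \<bar>takagi H (shifted_point n (Suc i)) - takagi H (shifted_point n i)\<bar> powr p"
  have le: "shifted_point n i \<le> 1" if "i \<le> 2 ^ n + 1" for i
  proof -
    have "shifted_point n i \<le> shifted_point n (2 ^ n + 1)"
      using strict_mono_on_leD[OF strict_mono_on_shifted_point, of i n "2 ^ n + 1"] that by simp
    then show ?thesis by (simp add: shifted_point_def)
  qed
  have "p_variation p (uniform_partition (1 / 2 ^ n) (1 / 2 ^ (n + 1))) (takagi H) 1 = (\<Sum>i<2 ^ n + 1. ?d i)"
    unfolding uniform_partition_shifted using strict_mono_on_shifted_point le by (rule p_variation_image)
  also have "{..<2 ^ n + 1} = insert 0 (insert (2 ^ n) {1..<(2 :: nat) ^ n})"
    by auto
  also have "(\<Sum>i\<in>insert 0 (insert (2 ^ n) {1..<(2 :: nat) ^ n}). ?d i) =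
      ?d 0 + ?d (2 ^ n) + (\<Sum>i\<in>{1..<2 ^ n}. ?d i)"
    by simp
  also have "(\<Sum>i\<in>{1..<2 ^ n}. ?d i) = interior_variation p H n"
    unfolding interior_variation_def
  proof (rule sum.cong)
    fix i assume i: "i \<in> {1..<(2 :: nat) ^ n}"
    have "shifted_point n (Suc i) = (2 * of_int (int i) + 1) / 2 ^ (n + 1)"
      "shifted_point n i = (2 * of_int (int i - 1) + 1) / 2 ^ (n + 1)"
      using i by (auto simp: shifted_point_def)
    then have "takagi H (shifted_point n (Suc i)) - takagi H (shifted_point n i) =
        (takagi H ((real i + 1) / 2 ^ n) - takagi H ((real i - 1) / 2 ^ n)) / 2"
      by (simp only: takagi_dyadic_midpoint[OF H]) (simp add: field_simps)
    then show "?d i = \<bar>(takagi H ((real i + 1) / 2 ^ n) - takagi H ((real i - 1) / 2 ^ n)) / 2\<bar> powr p"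
      by (simp only:)
  qed simp
  also have "?d 0 = \<bar>scaled_increment H (n + 1) 0\<bar> powr p / 2 ^ (n + 1)"
    unfolding powr_scaled_increment[OF assms, symmetric] by (simp add: shifted_point_def)
  also have "?d (2 ^ n) = \<bar>scaled_increment H (n + 1) (2 ^ (n + 1) - 1)\<bar> powr p / 2 ^ (n + 1)"
    unfolding powr_scaled_increment[OF assms, symmetric]
    by (simp add: shifted_point_def of_nat_diff del: power_Suc) simp
  finally show ?thesis by (simp add: add_divide_distrib)
qed

text \<open>The neighbours of an even point are midpoints of adjacent intervals of level
  \<open>n\<close>, and the midpoint formula halves the difference of that level. The neighbours of
  an odd point are the ends of one interval of level \<open>n\<close>. Both cases yield the factor
  \<open>2 powr (- p)\<close>.\<close>

lemma interior_variation_Suc: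
  assumes "p > 0" "H = 1 / p"
  shows "interior_variation p H (Suc n) =
    2 powr (- p) * (interior_variation p H n + dyadic_mean H n (\<lambda>x. \<bar>x\<bar> powr p))"
proof -
  have H: "H > 0" using assms by simp
  let ?D = "\<lambda>n i. \<bar>(takagi H ((real i + 1) / 2 ^ n) - takagi H ((real i - 1) / 2 ^ n)) / 2\<bar> powr p"
  have half: "\<bar>z / 2\<bar> powr p = 2 powr (- p) * \<bar>z\<bar> powr p" for z :: real
    by (simp add: powr_divide powr_minus_divide)
  have even: "?D (Suc n) (2 * i) = 2 powr (- p) * ?D n i" for i
  proof -
    have arg: "(real (2 * i) + 1) / 2 ^ Suc n = (2 * of_int (int i) + 1) / 2 ^ (n + 1)"
      "(real (2 * i) - 1) / 2 ^ Suc n = (2 * of_int (int i - 1) + 1) / 2 ^ (n + 1)"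
      by simp_all
    have "takagi H ((real (2 * i) + 1) / 2 ^ Suc n) - takagi H ((real (2 * i) - 1) / 2 ^ Suc n) =
        (takagi H ((real i + 1) / 2 ^ n) - takagi H ((real i - 1) / 2 ^ n)) / 2"
      unfolding arg by (simp only: takagi_dyadic_midpoint[OF H]) (simp add: field_simps)
    then show ?thesis by (simp only: half)
  qed
  have odd: "?D (Suc n) (2 * i + 1) = 2 powr (- p) * (\<bar>scaled_increment H n i\<bar> powr p / 2 ^ n)" for i
  proof -
    have "(real (2 * i + 1) + 1) / 2 ^ Suc n = (real i + 1) / 2 ^ n"
      "(real (2 * i + 1) - 1) / 2 ^ Suc n = real i / 2 ^ n"
      by (simp_all add: field_simps)
    then show ?thesis unfolding powr_scaled_increment[OF assms, symmetric] by (simp only: half)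
  qed
  \<comment> \<open>Splitting by parity needs sums starting at 0. The extra term at 0 is itself an
    even term, so it scales by the same factor and is removed on both sides.\<close>
  have from_0: "(\<Sum>i\<in>{1..<2 ^ m}. f i) = (\<Sum>i<2 ^ m. f i) - f 0" for f :: "nat \<Rightarrow> real" and m
    by (simp add: lessThan_atLeast0 sum.atLeast_Suc_lessThan)
  have "interior_variation p H (Suc n) =
      (\<Sum>i<2 ^ n. ?D (Suc n) (2 * i)) + (\<Sum>i<2 ^ n. ?D (Suc n) (2 * i + 1)) - ?D (Suc n) (2 * 0)"
    unfolding interior_variation_def from_0
    by (simp only: power_Suc[of "2 :: nat"] sum_lessThan_double mult_0_right)
  also have "\<dots> = 2 powr (- p) * (((\<Sum>i<2 ^ n. ?D n i) - ?D n 0) + dyadic_mean H n (\<lambda>x. \<bar>x\<bar> powr p))"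
    unfolding even odd dyadic_mean_def sum_divide_distrib
    by (simp only: sum_distrib_left[symmetric] ring_distribs)
  finally show ?thesis unfolding interior_variation_def from_0 .
qed

section \<open>Limits\<close>

text \<open>The limit \<open>L\<close> solves \<open>L = r * (L + c)\<close>. The distance to it
  contracts by \<open>r\<close> in each step, up to a perturbation that tends to 0.\<close>

lemma linear_recurrence_LIMSEQ:
  fixes x y :: "nat \<Rightarrow> real"
  assumes "\<And>n. x (Suc n) = r * (x n + y n)" "0 \<le> r" "r < 1" "y \<longlonglongrightarrow> c"
  shows "x \<longlonglongrightarrow> r * c / (1 - r)"
proof -
  define L where "L = r * c / (1 - r)"
  have L: "L = r * (L + c)" using assms by (simp add: L_def field_simps)
  have "x \<longlonglongrightarrow> L"
  proof (rule LIMSEQ_I)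
    fix e :: real assume "e > 0"
    \<comment> \<open>With this tolerance the error \<open>e / 2\<close> reproduces itself:
      \<open>r * (e / 2) + e / 2 * (1 - r) = e / 2\<close>.\<close>
    then have "e / 2 * (1 - r) > 0" using assms by simp
    then obtain N where N: "\<And>n. n \<ge> N \<Longrightarrow> \<bar>y n - c\<bar> < e / 2 * (1 - r)"
      using LIMSEQ_D[OF assms(4)] by (metis real_norm_def)
    have bound: "\<bar>x (N + k) - L\<bar> \<le> r ^ k * \<bar>x N - L\<bar> + e / 2" for k
    proof (induction k)
      case (Suc k)
      have "x (N + Suc k) - L = r * (x (N + k) - L) + r * (y (N + k) - c)"
        using assms(1)[of "N + k"] L by (simp add: algebra_simps)
      then have "\<bar>x (N + Suc k) - L\<bar> \<le> r * \<bar>x (N + k) - L\<bar> + r * \<bar>y (N + k) - c\<bar>"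
        using assms(2) abs_triangle_ineq[of "r * (x (N + k) - L)" "r * (y (N + k) - c)"]
        by (simp add: abs_mult)
      also have "\<dots> \<le> r * (r ^ k * \<bar>x N - L\<bar> + e / 2) + 1 * (e / 2 * (1 - r))"
        using assms N[of "N + k"] by (intro add_mono mult_mono Suc) auto
      also have "\<dots> = r ^ Suc k * \<bar>x N - L\<bar> + e / 2" by (simp add: field_simps)
      finally show ?case .
    qed (use \<open>e > 0\<close> in simp)
    have "(\<lambda>k. r ^ k * \<bar>x N - L\<bar>) \<longlonglongrightarrow> 0"
      using assms by (intro tendsto_mult_left_zero LIMSEQ_power_zero) auto
    then have "\<forall>\<^sub>F k in sequentially. r ^ k * \<bar>x N - L\<bar> < e / 2"
      using \<open>e > 0\<close> by (intro order_tendstoD(2)) auto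
    then obtain k0 where k0: "\<And>k. k \<ge> k0 \<Longrightarrow> r ^ k * \<bar>x N - L\<bar> < e / 2"
      by (auto simp: eventually_sequentially)
    have "norm (x n - L) < e" if "n \<ge> N + k0" for n
    proof -
      have "k0 \<le> n - N" "N + (n - N) = n" using that by auto
      then show ?thesis using bound[of "n - N"] k0[of "n - N"] by simp
    qed
    then show "\<exists>no. \<forall>n\<ge>no. norm (x n - L) < e" by blast
  qed
  then show ?thesis by (simp add: L_def)
qed

text \<open>The difference consists of the two end terms, whose scaled increments are uniformly
  bounded, divided by \<open>2 ^ (n + 1)\<close>.\<close>

lemma p_variation_takagi_shifted_diff_LIMSEQ:
  assumes "p > 1" "H = 1 / p"
  shows "(\<lambda>n. p_variation p (uniform_partition (1 / 2 ^ n) (1 / 2 ^ (n + 1))) (takagi H) 1 -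
    interior_variation p H n) \<longlonglongrightarrow> 0"
proof -
  define K :: real where "K = 2 powr (H - 1) / (1 - 2 powr (H - 1))"
  have p: "p > 0" using assms by simp
  have b: "\<bar>scaled_increment H n i\<bar> powr p \<le> K powr p" for n i
    using abs_scaled_increment_le[of H n i] assms by (intro powr_mono2) (auto simp: K_def)
  show ?thesis
  proof (rule Lim_null_comparison)
    show "\<forall>\<^sub>F n in sequentially. norm (p_variation p (uniform_partition (1 / 2 ^ n) (1 / 2 ^ (n + 1))) (takagi H) 1 -
        interior_variation p H n) \<le> K powr p * (1 / 2) ^ n"
    proof (intro always_eventually allI)
      fix n
      have "\<bar>scaled_increment H (n + 1) 0\<bar> powr p + \<bar>scaled_increment H (n + 1) (2 ^ (n + 1) - 1)\<bar> powr p \<le> 2 * K powr p"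
        using b[of "n + 1" 0] b[of "n + 1" "2 ^ (n + 1) - 1"] by simp
      then have "(\<bar>scaled_increment H (n + 1) 0\<bar> powr p +
          \<bar>scaled_increment H (n + 1) (2 ^ (n + 1) - 1)\<bar> powr p) / 2 ^ (n + 1) \<le> 2 * K powr p / 2 ^ (n + 1)"
        by (intro divide_right_mono) auto
      then show "norm (p_variation p (uniform_partition (1 / 2 ^ n) (1 / 2 ^ (n + 1))) (takagi H) 1 -
        interior_variation p H n) \<le> K powr p * (1 / 2) ^ n"
        unfolding p_variation_takagi_shifted[OF p assms(2)] by (simp add: power_one_over)
    qed
    show "(\<lambda>n. K powr p * (1 / 2) ^ n) \<longlonglongrightarrow> 0"
      by (intro tendsto_mult_right_zero LIMSEQ_power_zero) auto
  qed
qed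

section \<open>Failure of roughness and the two limits\<close>

lemma rough_paths_variation_LIMSEQ:
  assumes "((\<lambda>\<delta>. SUP l\<in>{0<..\<delta>}. SUP a\<in>{0..<l}. SUP t\<in>{0..1}.
      ereal \<bar>p_variation p (uniform_partition l a) x t - A t\<bar>) \<longlongrightarrow> 0) (at_right 0)"
    and "filterlim l (at_right 0) sequentially" "\<And>n. 0 \<le> a n" "\<And>n. a n < l n"
  shows "(\<lambda>n. p_variation p (uniform_partition (l n) (a n)) x 1) \<longlonglongrightarrow> A 1"
proof -
  let ?S = "\<lambda>\<delta>. SUP l\<in>{0<..\<delta>}. SUP a\<in>{0..<l}. SUP t\<in>{0..1}.
      ereal \<bar>p_variation p (uniform_partition l a) x t - A t\<bar>"
  let ?d = "\<lambda>n. \<bar>p_variation p (uniform_partition (l n) (a n)) x 1 - A 1\<bar>"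
  \<comment> \<open>The mesh \<open>l n\<close>, the shift \<open>a n\<close> and the time 1 are
    admissible in the three suprema at \<open>\<delta> = l n\<close>.\<close>
  have le: "ereal (?d n) \<le> ?S (l n)" for n
  proof -
    have "0 < l n" using assms(3,4)[of n] by simp
    have "ereal (?d n) \<le> (SUP t\<in>{0..1}. ereal \<bar>p_variation p (uniform_partition (l n) (a n)) x t - A t\<bar>)"
      by (rule SUP_upper) simp
    also have "\<dots> \<le> (SUP a\<in>{0..<l n}. SUP t\<in>{0..1}. ereal \<bar>p_variation p (uniform_partition (l n) a) x t - A t\<bar>)"
      using assms(3,4)[of n] by (intro SUP_upper) simp
    also have "\<dots> \<le> ?S (l n)"
      using \<open>0 < l n\<close> by (intro SUP_upper) simp
    finally show ?thesis .
  qed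
  have "(\<lambda>n. ?S (l n)) \<longlonglongrightarrow> 0" using assms(1,2) by (rule filterlim_compose)
  then have "(\<lambda>n. ereal (?d n)) \<longlonglongrightarrow> 0"
    by (rule tendsto_sandwich[OF _ _ tendsto_const, rotated 2]) (use le in \<open>auto intro!: always_eventually\<close>)
  then have "?d \<longlonglongrightarrow> 0" by (simp add: zero_ereal_def)
  then show ?thesis by (simp add: LIM_zero_iff tendsto_rabs_zero_iff)
qed

text \<open>The contradiction comes from the recursion alone, with \<open>A 1\<close> as the common
  limit, so no Rademacher sequence has to be constructed.\<close>

lemma takagi_notin_rough_paths:
  assumes "p > 1" "H = 1 / p"
  shows "takagi H \<notin> rough_paths p"
proof
  assume "takagi H \<in> rough_paths p"
  then obtain A :: "real \<Rightarrow> real" where A: "A 0 = 0" "A 1 > A 0"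
    "((\<lambda>\<delta>. SUP l\<in>{0<..\<delta>}. SUP a\<in>{0..<l}. SUP t\<in>{0..1}.
      ereal \<bar>p_variation p (uniform_partition l a) (takagi H) t - A t\<bar>) \<longlongrightarrow> 0) (at_right 0)"
    unfolding rough_paths_def by auto
  have p: "p > 0" using assms by simp
  have l: "filterlim (\<lambda>n. 1 / 2 ^ n :: real) (at_right 0) sequentially"
    using LIMSEQ_power_zero[of "1 / 2 :: real"]
    by (auto simp: filterlim_at power_one_over intro!: always_eventually)
  have V: "(\<lambda>n. dyadic_mean H n (\<lambda>x. \<bar>x\<bar> powr p)) \<longlonglongrightarrow> A 1"
    using rough_paths_variation_LIMSEQ[OF A(3) l, of "\<lambda>_. 0"]
    by (simp add: p_variation_takagi_dyadic[OF p assms(2)])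
  have "(\<lambda>n. p_variation p (uniform_partition (1 / 2 ^ n) (1 / 2 ^ (n + 1))) (takagi H) 1) \<longlonglongrightarrow> A 1"
    using rough_paths_variation_LIMSEQ[OF A(3) l, of "\<lambda>n. 1 / 2 ^ (n + 1)"]
    by (simp add: field_simps)
  from tendsto_diff[OF this p_variation_takagi_shifted_diff_LIMSEQ[OF assms]]
  have M: "interior_variation p H \<longlonglongrightarrow> A 1" by simp
  have "(\<lambda>n. interior_variation p H (Suc n)) \<longlonglongrightarrow> 2 powr (- p) * (A 1 + A 1)"
    unfolding interior_variation_Suc[OF p assms(2)] by (intro tendsto_intros M V)
  then have "A 1 = 2 powr (- p) * (A 1 + A 1)"
    using LIMSEQ_Suc[OF M] LIMSEQ_unique by blast
  \<comment> \<open>Division by \<open>A 1\<close> is possible because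
    \<open>A 1 > A 0 = 0\<close>.\<close>
  then have "2 powr (1 - p) = 1" using A by (simp add: powr_diff powr_minus field_simps)
  moreover have "2 powr (1 - p) < 1" using assms powr_less_mono[of "1 - p" 0 2] by simp
  ultimately show False by simp
qed

theorem proposition6p9:
  fixes p H q :: real
  assumes "p > 1" and "H = 1 / p" and "q = 2 powr (H - 1)"
  shows "(\<forall>(M :: 'a measure) \<epsilon> C. rademacher_sequence M \<epsilon> \<longrightarrow>
            C = (\<integral>\<omega>. \<bar>\<Sum>j. q ^ Suc j * \<epsilon> (Suc j) \<omega>\<bar> powr p \<partial>M) \<longrightarrow>
            (\<lambda>n. p_variation p (uniform_partition (1 / 2 ^ n) 0) (takagi H) 1)
               \<longlonglongrightarrow> C \<and>
            (\<lambda>n. p_variation p (uniform_partition (1 / 2 ^ n) (1 / 2 ^ (n + 1))) (takagi H) 1)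
               \<longlonglongrightarrow> C / (2 powr p - 1)) \<and>
         takagi H \<notin> rough_paths p"
proof (intro conjI allI impI)
  have p: "p > 0" and H: "0 < H" "H < 1" using assms by simp_all
  have q: "0 \<le> q" "q < 1" using assms(3) H powr_less_mono[of "H - 1" 0 2] by simp_all
  fix M :: "'a measure" and \<epsilon> C
  assume M: "rademacher_sequence M \<epsilon>"
    and C: "C = (\<integral>\<omega>. \<bar>\<Sum>j. q ^ Suc j * \<epsilon> (Suc j) \<omega>\<bar> powr p \<partial>M)"
  have "continuous_on UNIV (\<lambda>x :: real. \<bar>x\<bar> powr p)"
    using p by (intro continuous_on_powr' continuous_intros) auto
  from dyadic_mean_eq_expectation[OF H assms(3) M this]
  have V: "(\<lambda>n. dyadic_mean H n (\<lambda>x. \<bar>x\<bar> powr p)) \<longlonglongrightarrow> C"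
    using rademacher_series_moment_LIMSEQ[OF M q p] C by simp
  then show "(\<lambda>n. p_variation p (uniform_partition (1 / 2 ^ n) 0) (takagi H) 1) \<longlonglongrightarrow> C"
    by (simp add: p_variation_takagi_dyadic[OF p assms(2)])
  have "(2 :: real) powr (- p) < 1" "2 powr p > (1 :: real)"
    using p powr_less_mono[of "- p" 0 2] powr_less_mono[of 0 p 2] by simp_all
  \<comment> \<open>The recurrence has ratio \<open>r = 2 powr (- p)\<close> and is driven by the
    dyadic means, which converge to \<open>C\<close>.\<close>
  then have "interior_variation p H \<longlonglongrightarrow> 2 powr (- p) * C / (1 - 2 powr (- p))"
    by (intro linear_recurrence_LIMSEQ[OF interior_variation_Suc[OF p assms(2)] _ _ V]) auto
  moreover have "2 powr (- p) * C / (1 - 2 powr (- p)) = C / (2 powr p - 1)"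
    using \<open>2 powr p > 1\<close> by (simp add: powr_minus field_simps)
  ultimately have "interior_variation p H \<longlonglongrightarrow> C / (2 powr p - 1)" by (simp only:)
  from tendsto_add[OF p_variation_takagi_shifted_diff_LIMSEQ[OF assms(1,2)] this]
  show "(\<lambda>n. p_variation p (uniform_partition (1 / 2 ^ n) (1 / 2 ^ (n + 1))) (takagi H) 1)
      \<longlonglongrightarrow> C / (2 powr p - 1)"
    by simp
qed (rule takagi_notin_rough_paths[OF assms(1,2)])

end
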